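(* For $1<R\le 3/2$, the greedy algorithm which, in each round $i$, sets $B_i=B_{i-1}\cup\{e_i\}$ if $s(B_{i-1}\cup\{e_i\})\le R$ and $B_i=B_{i-1}$ otherwise (starting from $B_0=\emptyset$), is $\frac{1}{R-1}$-competitive for the proportional\&non-removable online knapsack problem with a buffer of capacity $R$.
   Context: Online knapsack problem with a resource buffer: there is a knapsack of capacity $1$ and a buffer of capacity $R\ge 1$. Items $e_1,\dots,e_n$ arrive one by one; each item $e$ has size $0<s(e)\le 1$ and value $v(e)\ge 0$; $s(B),v(B)$ denote sums over a set $B$. A deterministic online algorithm maintains buffer contents $B_0=\emptyset,B_1,\dots,B_n$, with $B_i$ chosen after seeing only $e_1,\dots,e_i$, $B_i\subseteq B_{i-1}\cup\{e_i\}$, $s(B_i)\le R$; in the non-removable setting additionally $B_{i-1}\subseteq B_i$. $\mathrm{ALG}(I)=\max\{v(B)\mid B\subseteq B_n,\ s(B)\le 1\}$, $\mathrm{OPT}(I)=\max\{v(B)\mid B\subseteq\{e_1,\dots,e_n\},\ s(B)\le 1\}$. "Proportional" means $v(e)=s(e)$ for every item. An algorithm is $c$-competitive if $\mathrm{OPT}(I)\le c\cdot\mathrm{ALG}(I)$ for every input $I$. *)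

theory Defs
  imports Complex_Main
begin

datatype item = Item (isize: real) (ival: real)

text \<open>An input is the list of its items in order of arrival.  Distinct items may agree in size and
  value, so an item is identified with its (0-based) position, and sets of items are sets of
  positions: the item \<open>e\<^sub>i\<close> arriving in round \<open>i\<close> is position \<open>i - 1\<close>.\<close>

definition valid_inputs :: "item list set" where
  "valid_inputs = {I. \<forall>e\<in>set I. 0 < isize e \<and> isize e \<le> 1 \<and> 0 \<le> ival e}"

definition proportional_inputs :: "item list set" where
  "proportional_inputs = {I \<in> valid_inputs. \<forall>e\<in>set I. ival e = isize e}"

definition total_size :: "item list \<Rightarrow> nat set \<Rightarrow> real" where
  "total_size I B = (\<Sum>i\<in>B. isize (I ! i))"

definition total_value :: "item list \<Rightarrow> nat set \<Rightarrow> real" where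
  "total_value I B = (\<Sum>i\<in>B. ival (I ! i))"

text \<open>A deterministic online algorithm maps the sequence of items seen so far to the current buffer
  contents.  On input \<open>I\<close> the contents after round \<open>i\<close> are thus \<open>A (take i I)\<close>, which cannot
  depend on later items.\<close>

type_synonym algorithm = "item list \<Rightarrow> nat set"

definition online_algorithm :: "real \<Rightarrow> item list set \<Rightarrow> algorithm \<Rightarrow> bool" where
  "online_algorithm R \<I> A \<longleftrightarrow>
     (\<forall>I\<in>\<I>. A [] = {} \<and>
       (\<forall>i<length I. A (take (Suc i) I) \<subseteq> A (take i I) \<union> {i} \<and>
                     total_size I (A (take (Suc i) I)) \<le> R))"

definition non_removable :: "item list set \<Rightarrow> algorithm \<Rightarrow> bool" where
  "non_removable \<I> A \<longleftrightarrow>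
     (\<forall>I\<in>\<I>. \<forall>i<length I. A (take i I) \<subseteq> A (take (Suc i) I))"

definition ALG :: "algorithm \<Rightarrow> item list \<Rightarrow> real" where
  "ALG A I = Max {total_value I B | B. B \<subseteq> A I \<and> total_size I B \<le> 1}"

definition OPT :: "item list \<Rightarrow> real" where
  "OPT I = Max {total_value I B | B. B \<subseteq> {..<length I} \<and> total_size I B \<le> 1}"

definition competitive :: "real \<Rightarrow> item list set \<Rightarrow> algorithm \<Rightarrow> bool" where
  "competitive c \<I> A \<longleftrightarrow> (\<forall>I\<in>\<I>. OPT I \<le> c * ALG A I)"

primrec greedy_buffer :: "real \<Rightarrow> item list \<Rightarrow> nat \<Rightarrow> nat set" where
  "greedy_buffer R I 0 = {}"
| "greedy_buffer R I (Suc i) =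
     (if total_size I (greedy_buffer R I i \<union> {i}) \<le> R
      then greedy_buffer R I i \<union> {i} else greedy_buffer R I i)"

definition greedy :: "real \<Rightarrow> algorithm" where
  "greedy R I = greedy_buffer R I (length I)"

lemma greedy_buffer_subset: "greedy_buffer R I i \<subseteq> {..<i}"
  by (induction i) (auto simp: less_Suc_eq)

lemma greedy_buffer_take: "i \<le> k \<Longrightarrow> greedy_buffer R (take k I) i = greedy_buffer R I i"
proof (induction i)
  case (Suc i)
  have "total_size (take k I) (greedy_buffer R I i \<union> {i}) = total_size I (greedy_buffer R I i \<union> {i})"
    unfolding total_size_def
    using Suc.prems greedy_buffer_subset[of R I i] by (intro sum.cong) auto
  with Suc show ?case by simp
qed simp

lemma greedy_take: "i \<le> length I \<Longrightarrow> greedy R (take i I) = greedy_buffer R I i"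
  by (simp add: greedy_def greedy_buffer_take min_absorb2)

end

theory Submission
  imports Defs
begin

text \<open>If greedy accepts every item, then ALG equals OPT.  Otherwise some rejected item of size at
  most 1 did not fit, so the buffer has total size above \<open>R - 1\<close>.  As \<open>R - 1 \<le> 1/2\<close>, it then contains
  a subset of size between \<open>R - 1\<close> and 1: while the total exceeds 1, either a single item already has
  size at least \<open>R - 1\<close>, or discarding any item leaves more than \<open>1 - (R - 1) \<ge> R - 1\<close>.  Since OPT is
  at most 1 on proportional inputs, the ratio follows.\<close>

lemma exists_subset_sum_between:
  fixes f :: "'a \<Rightarrow> real"
  assumes "finite B" and "\<And>x. x \<in> B \<Longrightarrow> f x \<le> 1" and "d \<le> 1 / 2" and "d \<le> sum f B"
  shows "\<exists>C\<subseteq>B. d \<le> sum f C \<and> sum f C \<le> 1"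
  using assms
proof (induction B rule: finite_induct)
  case empty
  then show ?case by simp
next
  case (insert x B)
  consider "sum f (insert x B) \<le> 1" | "d \<le> f x" | "1 < sum f (insert x B)" "f x < d"
    by linarith
  then show ?case
  proof cases
    case 1
    with insert.prems show ?thesis by blast
  next
    case 2
    with insert.prems(1)[of x] show ?thesis by (intro exI[of _ "{x}"]) auto
  next
    case 3
    \<comment> \<open>The rest weighs more than \<open>1 - d\<close>, which is at least
      \<open>d\<close> because \<open>d \<le> 1 / 2\<close>.\<close>
    with insert.hyps insert.prems(2) have "d \<le> sum f B" by simp
    with insert.IH insert.prems show ?thesis by blast
  qed
qed

lemma total_value_proportional:
  assumes "I \<in> proportional_inputs" and "B \<subseteq> {..<length I}"
  shows "total_value I B = total_size I B"
  using assms by (auto simp: proportional_inputs_def total_value_def total_size_def intro!: sum.cong)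

lemma isize_nth_bounds:
  assumes "I \<in> proportional_inputs" and "i < length I"
  shows "0 < isize (I ! i)" and "isize (I ! i) \<le> 1"
  using assms by (auto simp: proportional_inputs_def valid_inputs_def)

lemma total_value_le_ALG:
  assumes "finite (A I)" and "C \<subseteq> A I" and "total_size I C \<le> 1"
  shows "total_value I C \<le> ALG A I"
  unfolding ALG_def using assms by (intro Max_ge) auto

lemma OPT_le_1:
  assumes "I \<in> proportional_inputs"
  shows "OPT I \<le> 1"
proof -
  let ?S = "{total_value I B | B. B \<subseteq> {..<length I} \<and> total_size I B \<le> 1}"
  have "finite ?S" by auto
  \<comment> \<open>The empty packing is feasible, so the maximum is attained; the value of an
    optimal packing is its size.\<close>
  moreover have "total_value I {} \<in> ?S"
    by (auto simp: total_size_def)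
  ultimately have "OPT I \<in> ?S"
    unfolding OPT_def by (intro Max_in) auto
  with assms show ?thesis by (auto simp: total_value_proportional)
qed

lemma total_size_greedy_buffer_le: "0 \<le> R \<Longrightarrow> total_size I (greedy_buffer R I i) \<le> R"
  by (induction i) (auto simp: total_size_def)

text \<open>An invariant of the rounds: the first rejection needs a total above \<open>R\<close>
  minus an item size of at most 1. From then on the total never drops, since nothing is removed and
  sizes are positive.\<close>

lemma greedy_buffer_full_or_large:
  assumes I: "I \<in> proportional_inputs" and "i \<le> length I"
  shows "greedy_buffer R I i = {..<i} \<or> R - 1 < total_size I (greedy_buffer R I i)"
  using assms(2)
proof (induction i)
  case (Suc i)
  have fresh: "finite (greedy_buffer R I i)" "i \<notin> greedy_buffer R I i"
    using greedy_buffer_subset[of R I i] finite_subset by auto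
  then have "total_size I (insert i (greedy_buffer R I i))
      = isize (I ! i) + total_size I (greedy_buffer R I i)"
    by (simp add: total_size_def)
  moreover have "0 < isize (I ! i)" "isize (I ! i) \<le> 1"
    using I Suc.prems isize_nth_bounds by auto
  ultimately show ?case
    using Suc by (auto simp: lessThan_Suc)
qed simp

lemma online_algorithm_greedy:
  assumes "0 \<le> R"
  shows "online_algorithm R \<I> (greedy R)"
  unfolding online_algorithm_def
proof (intro ballI conjI allI impI)
  show "greedy R [] = {}" by (simp add: greedy_def)
next
  fix I :: "item list" and i assume "i < length I"
  then show "greedy R (take (Suc i) I) \<subseteq> greedy R (take i I) \<union> {i}"
    and "total_size I (greedy R (take (Suc i) I)) \<le> R"
    using total_size_greedy_buffer_le[OF assms, of I "Suc i"]
    \<comment> \<open>The recursion stays folded so that the size bound at \<open>Suc i\<close>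
      matches; the second call unfolds it for the inclusion.\<close>
    by (auto simp: greedy_take simp del: greedy_buffer.simps(2))
      (auto split: if_splits)
qed

lemma non_removable_greedy: "non_removable \<I> (greedy R)"
  by (auto simp: non_removable_def greedy_take)

lemma competitive_greedy:
  assumes R: "1 < R" "R \<le> 3 / 2"
  shows "competitive (1 / (R - 1)) proportional_inputs (greedy R)"
  unfolding competitive_def
proof
  fix I assume I: "I \<in> proportional_inputs"
  let ?B = "greedy R I"
  have sub: "?B \<subseteq> {..<length I}"
    using greedy_buffer_subset by (simp add: greedy_def)
  then have fin: "finite ?B"
    using finite_subset by blast
  consider "?B = {..<length I}" | "R - 1 < total_size I ?B"
    using greedy_buffer_full_or_large[OF I order.refl] by (auto simp: greedy_def)
  then show "OPT I \<le> 1 / (R - 1) * ALG (greedy R) I"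
  proof cases
    case 1
    \<comment> \<open>Both maxima range over the same packings.\<close>
    then have "OPT I = ALG (greedy R) I"
      by (simp add: OPT_def ALG_def)
    moreover have "0 \<le> ALG (greedy R) I"
      using total_value_le_ALG[of "greedy R" I "{}"] fin by (simp add: total_size_def total_value_def)
    \<comment> \<open>The factor \<open>1 / (R - 1)\<close> is at least 2, so it can only enlarge
      the nonnegative \<open>ALG\<close>.\<close>
    ultimately show ?thesis
      using R mult_right_mono[of 1 "1 / (R - 1)" "ALG (greedy R) I"] by simp
  next
    case 2
    \<comment> \<open>With \<open>d = R - 1\<close>, the bound \<open>R \<le> 3 / 2\<close> is
      exactly \<open>d \<le> 1 / 2\<close>.\<close>
    obtain C where C: "C \<subseteq> ?B" "R - 1 \<le> total_size I C" "total_size I C \<le> 1"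
      using exists_subset_sum_between[of ?B "\<lambda>i. isize (I ! i)" "R - 1"] fin sub 2 R
        isize_nth_bounds(2)[OF I]
      by (auto simp: total_size_def subset_iff)
    then have "R - 1 \<le> ALG (greedy R) I"
      using total_value_le_ALG[of "greedy R" I C] fin C total_value_proportional[OF I, of C] sub by auto
    then have "1 \<le> 1 / (R - 1) * ALG (greedy R) I"
      using R by simp
    with OPT_le_1[OF I] show ?thesis by linarith
  qed
qed

theorem theorem4:
  fixes R :: real
  assumes "1 < R" and "R \<le> 3 / 2"
  shows "online_algorithm R proportional_inputs (greedy R) \<and>
         non_removable proportional_inputs (greedy R) \<and>
         competitive (1 / (R - 1)) proportional_inputs (greedy R)"
  using assms by (simp add: online_algorithm_greedy non_removable_greedy competitive_greedy)

end
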